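(* There exists a unique tree series $Z$ with coefficients in $\mathbb{Q}(q)[x]$ such that $$q\,\Sigma_q Z-\mathrm{Crls}\diamond(Z,-\bullet)=q\,(1+(q-1)x)\,\mathrm{Crls}\diamond(\bullet,\,q\,\Sigma_q Z)-\bullet .$$
   Context: $q$ and $x$ are indeterminates. A tree is a finite rooted tree (finite connected acyclic graph with a distinguished vertex, the root), considered up to isomorphism. $\#T$ is the number of vertices of $T$, $\mathrm{aut}(T)$ is the order of its automorphism group, and $\bullet$ is the one-vertex tree. A tree series over a commutative $\mathbb{Q}$-algebra $R$ is a formal infinite sum $A=\sum_T A_T\,\frac{T}{\mathrm{aut}(T)}$ over all trees, with $A_T\in R$ (the coefficient of $T$ in $A$); $\bullet$ is also viewed as a tree series. For $\alpha\in R$ the suspension $\Sigma_\alpha$ is defined by $(\Sigma_\alpha A)_T=\alpha^{\#T-1}A_T$. For tree series $A,B$, the tree series $\mathrm{Crls}\diamond(A,B)$ is defined by $$(\mathrm{Crls}\diamond(A,B))_T=\sum_{T_0}A_{T_0}\prod_{T'}B_{T'},$$ where $T_0$ runs over the subtrees (connected sets of vertices) of $T$ containing the root of $T$ (and rooted there), and $T'$ runs over the connected components of the complement of $T_0$ in $T$, each rooted at its vertex closest to the root of $T$ (an empty product is $1$). *)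

theory Defs
  imports
    "Graph_Theory.Digraph_Component"
    "HOL-Combinatorics.Permutations"
    "HOL-Computational_Algebra.Fraction_Field"
    "HOL-Computational_Algebra.Polynomial"
begin

section \<open>Rooted trees on a concrete vertex set\<close>

text \<open>
  Graphs are the finite simple symmetric digraphs (\<^locale>\<open>pair_graph\<close>) of the AFP entry
  Graph_Theory, and a rooted graph is a graph paired with a vertex.  A symmetric digraph has a
  directed cycle \<open>u, v, u\<close> along every edge, so that the constants \<open>forest\<close> and \<open>tree\<close> of that
  entry are not the notions for undirected graphs: acyclicity has to be the absence of cycles of
  length at least 3.
\<close>

type_synonym 'v rgraph = "'v pair_pre_digraph \<times> 'v"

definition undirected_acyclic :: "'v pair_pre_digraph \<Rightarrow> bool" where
  "undirected_acyclic G \<longleftrightarrow> \<not> (\<exists>p. pre_digraph.cycle (with_proj G) p \<and> 3 \<le> length p)"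

fun is_rooted_tree :: "'v rgraph \<Rightarrow> bool" where
  "is_rooted_tree (G, r) \<longleftrightarrow>
     pair_graph G \<and> connected (with_proj G) \<and> undirected_acyclic G \<and> r \<in> pverts G"

fun rooted_iso :: "('v \<Rightarrow> 'w) \<Rightarrow> 'v rgraph \<Rightarrow> 'w rgraph \<Rightarrow> bool" where
  "rooted_iso f (G, r) (H, s) \<longleftrightarrow>
     bij_betw f (pverts G) (pverts H) \<and>
     (\<forall>u\<in>pverts G. \<forall>v\<in>pverts G. (u, v) \<in> parcs G \<longleftrightarrow> (f u, f v) \<in> parcs H) \<and>
     f r = s"

definition rooted_tree_iso :: "'v rgraph \<Rightarrow> 'w rgraph \<Rightarrow> bool" where
  "rooted_tree_iso T U \<longleftrightarrow> is_rooted_tree T \<and> is_rooted_tree U \<and> (\<exists>f. rooted_iso f T U)"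

definition pinduced :: "'v pair_pre_digraph \<Rightarrow> 'v set \<Rightarrow> 'v pair_pre_digraph" where
  "pinduced G S = \<lparr>pverts = S, parcs = parcs G \<inter> S \<times> S\<rparr>"

definition root_subtrees :: "'v pair_pre_digraph \<Rightarrow> 'v \<Rightarrow> 'v set set" where
  "root_subtrees G r = {S. r \<in> S \<and> S \<subseteq> pverts G \<and> connected (with_proj (pinduced G S))}"

text \<open>In a symmetric digraph the strongly connected components are the connected components.\<close>

definition complement_components :: "'v pair_pre_digraph \<Rightarrow> 'v set \<Rightarrow> 'v set set" where
  "complement_components G S =
     pre_digraph.sccs_verts (with_proj (pinduced G (pverts G - S)))"

definition graph_dist :: "'v pair_pre_digraph \<Rightarrow> 'v \<Rightarrow> 'v \<Rightarrow> nat" where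
  "graph_dist G u v = (LEAST n. (u, v) \<in> parcs G ^^ n)"

definition closest_vertex :: "'v pair_pre_digraph \<Rightarrow> 'v \<Rightarrow> 'v set \<Rightarrow> 'v" where
  "closest_vertex G r C = arg_min_on (graph_dist G r) C"

lemma pinduced_simps [simp]:
  "pverts (pinduced G S) = S" "parcs (pinduced G S) = parcs G \<inter> S \<times> S"
  by (auto simp: pinduced_def)

lemma connected_sym_iff:
  assumes "pair_graph G"
  shows "connected (with_proj G) \<longleftrightarrow>
           pverts G \<noteq> {} \<and> (\<forall>u\<in>pverts G. \<forall>v\<in>pverts G. (u, v) \<in> (parcs G)\<^sup>*)"
proof -
  interpret pair_graph G by fact
  have s: "(u, v) \<in> parcs G \<Longrightarrow> (v, u) \<in> parcs G" for u v
    using graph_symmetric by simp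
  have "parcs (mk_symmetric (with_proj G)) = parcs G"
    unfolding mk_symmetric_def using s by auto
  moreover have "pverts (mk_symmetric (with_proj G)) = pverts G"
    unfolding mk_symmetric_def by simp
  ultimately have "mk_symmetric (with_proj G) = G" by simp
  then show ?thesis
    unfolding connected_def strongly_connected_def
    using reachable_conv' by (auto)
qed

lemma pair_graph_pinduced:
  assumes "pair_graph G" "S \<subseteq> pverts G"
  shows "pair_graph (pinduced G S)"
proof -
  interpret pair_graph G by fact
  have s: "(u, v) \<in> parcs G \<Longrightarrow> (v, u) \<in> parcs G" for u v
    using graph_symmetric by simp
  show ?thesis
  proof (unfold_locales)
    show "finite (pverts (pinduced G S))"
      using finite_subset[OF assms(2) pair_finite_verts] by simp
    show "symmetric (with_proj (pinduced G S))"
      by (auto simp: symmetric_def sym_def s)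
  qed (use pair_finite_arcs pair_no_loops in auto)
qed

lemma acyclic_pinduced:
  assumes "pair_graph G" "S \<subseteq> pverts G" "undirected_acyclic G"
  shows "undirected_acyclic (pinduced G S)"
proof -
  interpret G: pair_graph G by fact
  interpret H: pair_graph "pinduced G S" by (rule pair_graph_pinduced[OF assms(1,2)])
  have "subgraph (with_proj (pinduced G S)) (with_proj G)"
    unfolding subgraph_def using assms(2) G.wf_digraph H.wf_digraph by auto
  then show ?thesis
    using assms(3) G.subgraph_cycle unfolding undirected_acyclic_def by blast
qed

lemma is_rooted_tree_pinduced:
  assumes "is_rooted_tree (G, r)" "S \<subseteq> pverts G" "connected (with_proj (pinduced G S))" "v \<in> S"
  shows "is_rooted_tree (pinduced G S, v)"
  using assms pair_graph_pinduced[of G S] acyclic_pinduced[of G S] by auto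

lemma pawalk_verts_snoc:
  "pcas u q p \<Longrightarrow> pawalk_verts u (q @ [(p, w)]) = pawalk_verts u q @ [w]"
  by (induction q arbitrary: u) auto

lemma acyclic_bridge:
  assumes G: "pair_graph G" and ac: "undirected_acyclic G" and e: "(p, u) \<in> parcs G"
    and path: "(u, p) \<in> (parcs G - {(p, u), (u, p)})\<^sup>*"
  shows False
proof -
  interpret G: pair_graph G by fact
  define H where "H = \<lparr>pverts = pverts G, parcs = parcs G - {(p, u), (u, p)}\<rparr>"
  interpret H: pair_wf_digraph H
    by unfold_locales (auto simp: H_def dest: G.wellformed')
  have up: "u \<in> pverts G" "p \<in> pverts G" using e by (auto dest: G.wellformed')
  have ne: "p \<noteq> u" using G.pair_no_loops[OF e] by simp
  have "u \<rightarrow>\<^sup>*\<^bsub>with_proj H\<^esub> p"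
    using H.reachable_conv'[of u p] up path by (simp add: H_def)
  then obtain q where q: "H.apath u q p" using H.reachable_apath by blast
  then have w: "H.awalk u q p" and d: "distinct (pawalk_verts u q)"
    by (auto simp: H.apath_def)
  have set: "set q \<subseteq> parcs G - {(p, u), (u, p)}" and cas: "pcas u q p"
    using w unfolding H.awalk_def by (simp_all add: H_def)
  have Gw: "G.awalk u q p" using set cas up by (auto simp: G.awalk_def)
  have "G.awalk p [(p, u)] u" using e up by (auto simp: G.awalk_def)
  then have W: "G.awalk u (q @ [(p, u)]) u" using Gw by (auto simp: G.awalk_def G.cas_append_iff)
  have vs: "pawalk_verts u (q @ [(p, u)]) = pawalk_verts u q @ [u]"
    using cas by (rule pawalk_verts_snoc)
  have hd: "pawalk_verts u q \<noteq> [] \<and> hd (pawalk_verts u q) = u"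
    using cas by (cases q) auto
  then have "distinct (tl (pawalk_verts u (q @ [(p, u)])))"
    using d unfolding vs by (cases "pawalk_verts u q") auto
  with W have cyc: "pre_digraph.cycle (with_proj G) (q @ [(p, u)])"
    unfolding G.cycle_def by auto
  have "2 \<le> length q"
  proof (rule ccontr)
    assume "\<not> 2 \<le> length q"
    then have "q = [] \<or> (\<exists>a. q = [a])" by (cases q; cases "tl q") auto
    then show False using cas set ne by auto
  qed
  then show False using cyc ac unfolding undirected_acyclic_def by force
qed

text \<open>The vertex of a connected set that is closest to the root is well defined.\<close>

lemma closest_unique:
  assumes T: "is_rooted_tree (G, r)" and C: "C \<subseteq> pverts G"
    and conn: "connected (with_proj (pinduced G C))"
    and u: "u \<in> C" and v: "v \<in> C"
    and minu: "\<And>w. w \<in> C \<Longrightarrow> graph_dist G r u \<le> graph_dist G r w"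
    and minv: "\<And>w. w \<in> C \<Longrightarrow> graph_dist G r v \<le> graph_dist G r w"
  shows "u = v"
proof (rule ccontr)
  assume ne: "u \<noteq> v"
  have G: "pair_graph G" and cG: "connected (with_proj G)" and ac: "undirected_acyclic G"
    and r: "r \<in> pverts G" using T by auto
  interpret pair_graph G by fact
  define d where "d = graph_dist G r u"
  have dv: "graph_dist G r v = d" using minu[OF v] minv[OF u] by (simp add: d_def)
  have reach: "\<exists>n. (r, w) \<in> parcs G ^^ n" if "w \<in> pverts G" for w
    using cG r that rtrancl_imp_relpow unfolding connected_sym_iff[OF G] by blast
  have walk: "(r, w) \<in> parcs G ^^ graph_dist G r w" if "w \<in> pverts G" for w
    using reach[OF that] unfolding graph_dist_def by (rule LeastI_ex)
  have le: "graph_dist G r w \<le> n" if "(r, w) \<in> parcs G ^^ n" for w n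
    using that unfolding graph_dist_def by (rule Least_le)
  have wu: "(r, u) \<in> parcs G ^^ d" using walk u C by (auto simp: d_def)
  have wv: "(r, v) \<in> parcs G ^^ d" using walk[of v] v C dv by auto
  have "d \<noteq> 0" using wu wv ne by (cases d) auto
  then obtain d' where d': "d = Suc d'" by (cases d) auto
  obtain p where p: "(r, p) \<in> parcs G ^^ d'" "(p, u) \<in> parcs G" using wu d' by auto
  obtain p' where p': "(r, p') \<in> parcs G ^^ d'" "(p', v) \<in> parcs G" using wv d' by auto
  define R where "R = parcs G - {(p, u), (u, p)}"
  have short: "(r, w) \<in> R\<^sup>*" if "(r, w) \<in> parcs G ^^ n" "n < d" for n w
    using that
  proof (induction n arbitrary: w)
    case (Suc n)
    then obtain w' where w': "(r, w') \<in> parcs G ^^ n" "(w', w) \<in> parcs G" by auto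
    have "w \<noteq> u" "w' \<noteq> u" using le[OF Suc.prems(1)] le[OF w'(1)] Suc.prems(2) by (auto simp: d_def)
    then have "(w', w) \<in> R" using w'(2) by (auto simp: R_def)
    moreover have "(r, w') \<in> R\<^sup>*" using Suc.IH[OF w'(1)] Suc.prems(2) by simp
    ultimately show ?case by (rule rtrancl_into_rtrancl[rotated])
  qed auto
  have rp: "(r, p) \<in> R\<^sup>*" using short[OF p(1)] d' by simp
  have "p' \<noteq> u" using le[OF p'(1)] d' by (auto simp: d_def)
  then have "(p', v) \<in> R" using p'(2) ne by (auto simp: R_def)
  then have rv: "(r, v) \<in> R\<^sup>*" using short[OF p'(1)] d' by auto
  have "p \<notin> C" using minu[of p] le[OF p(1)] d' by (auto simp: d_def)
  then have "parcs (pinduced G C) \<subseteq> R" by (auto simp: R_def)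
  moreover have "(u, v) \<in> (parcs (pinduced G C))\<^sup>*"
    using conn u v unfolding connected_sym_iff[OF pair_graph_pinduced[OF G C]] by simp
  ultimately have uv: "(u, v) \<in> R\<^sup>*" using rtrancl_mono by blast
  have "sym R" unfolding R_def using graph_symmetric by (auto simp: sym_def)
  then have "(v, r) \<in> R\<^sup>*" using rv by (meson sym_rtrancl symD)
  then have "(u, p) \<in> R\<^sup>*" using uv rp by (meson rtrancl_trans)
  then show False using acyclic_bridge[OF G ac p(2)] by (simp add: R_def)
qed

lemma closest_vertex_in:
  assumes "finite C" "C \<noteq> {}"
  shows "closest_vertex G r C \<in> C"
    and "\<And>w. w \<in> C \<Longrightarrow> graph_dist G r (closest_vertex G r C) \<le> graph_dist G r w"
  unfolding closest_vertex_def using arg_min_if_finite[OF assms] arg_min_least[OF assms] by auto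

lemma complement_components_props:
  assumes G: "pair_graph G" and C: "C \<in> complement_components G S"
  shows "C \<subseteq> pverts G - S" "C \<noteq> {}" "connected (with_proj (pinduced G C))"
proof -
  define H where "H = pinduced G (pverts G - S)"
  interpret H: pair_graph H unfolding H_def by (rule pair_graph_pinduced[OF G]) auto
  have C': "C \<in> H.sccs_verts" using C by (simp add: complement_components_def H_def)
  show sub: "C \<subseteq> pverts G - S" using H.sccs_verts_subsets[OF C'] by (simp add: H_def)
  show ne: "C \<noteq> {}" using C' by (simp add: H.sccs_verts_def)
  have eq: "with_proj (pinduced G C) = with_proj H \<restriction> C"
    using sub by (auto simp: with_proj_def induce_subgraph_def pinduced_def H_def)
  have "with_proj H \<restriction> C \<in> H.sccs" using H.in_sccs_verts_conv C' by simp
  then have sc: "strongly_connected (with_proj (pinduced G C))"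
    unfolding eq H.sccs_def by simp
  interpret K: pair_graph "pinduced G C"
    by (rule pair_graph_pinduced[OF G]) (use sub in auto)
  show "connected (with_proj (pinduced G C))"
    using sc connected_sym_iff[OF K.pair_graph_axioms] K.reachable_conv'
    by (auto simp: strongly_connected_def)
qed

subsection \<open>Invariance under isomorphism\<close>

lemma rooted_iso_inv:
  assumes "rooted_iso f (G, r) (H, s)" "r \<in> pverts G"
  shows "rooted_iso (inv_into (pverts G) f) (H, s) (G, r)"
proof -
  have b: "bij_betw f (pverts G) (pverts H)" using assms by simp
  note inv = bij_betw_inv_into[OF b] bij_betw_inv_into_right[OF b] bij_betw_inv_into_left[OF b]
  have "inv_into (pverts G) f u \<in> pverts G" if "u \<in> pverts H" for u
    using inv(1) that by (rule bij_betwE[rule_format])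
  then show ?thesis using assms inv by auto
qed

lemma rooted_iso_comp:
  assumes "rooted_iso f (G, r) (H, s)" "rooted_iso g (H, s) (K, t)"
  shows "rooted_iso (g \<circ> f) (G, r) (K, t)"
proof -
  have b: "bij_betw f (pverts G) (pverts H)" using assms by simp
  then have "f u \<in> pverts H" if "u \<in> pverts G" for u using that by (auto dest: bij_betwE)
  then show ?thesis using assms by (auto intro: bij_betw_trans)
qed

lemma rooted_tree_iso_sym:
  assumes "rooted_tree_iso T U"
  shows "rooted_tree_iso U T"
proof -
  obtain G r H s where TU: "T = (G, r)" "U = (H, s)" by (cases T; cases U)
  obtain f where f: "rooted_iso f (G, r) (H, s)"
    using assms unfolding rooted_tree_iso_def TU by blast
  have "r \<in> pverts G" using assms by (simp add: rooted_tree_iso_def TU)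
  from rooted_iso_inv[OF f this] show ?thesis
    using assms unfolding rooted_tree_iso_def TU by blast
qed

lemma rooted_tree_iso_trans:
  assumes "rooted_tree_iso T U" "rooted_tree_iso U W"
  shows "rooted_tree_iso T W"
proof -
  obtain G r H s K t where TUW: "T = (G, r)" "U = (H, s)" "W = (K, t)"
    by (cases T; cases U; cases W)
  obtain f where f: "rooted_iso f (G, r) (H, s)"
    using assms(1) unfolding rooted_tree_iso_def TUW by blast
  obtain g where g: "rooted_iso g (H, s) (K, t)"
    using assms(2) unfolding rooted_tree_iso_def TUW by blast
  from rooted_iso_comp[OF f g] show ?thesis
    using assms unfolding rooted_tree_iso_def TUW by blast
qed

lemma rooted_iso_id: "rooted_iso id T T"
  by (cases T) auto

lemma rooted_tree_iso_refl: "is_rooted_tree T \<Longrightarrow> rooted_tree_iso T T"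
  unfolding rooted_tree_iso_def using rooted_iso_id by blast

lemma single_vertex_tree: "is_rooted_tree (\<lparr>pverts = {v}, parcs = {}\<rparr>, v)"
proof -
  let ?G = "\<lparr>pverts = {v}, parcs = {}\<rparr>"
  interpret pair_graph ?G by unfold_locales (auto simp: symmetric_def sym_def)
  have "undirected_acyclic ?G"
    unfolding undirected_acyclic_def cycle_def awalk_def by auto
  then show ?thesis
    using pair_graph_axioms connected_sym_iff[OF pair_graph_axioms] by simp
qed

lemma rooted_iso_pinduced:
  assumes "rooted_iso f (G, r) (H, s)" "S \<subseteq> pverts G"
  shows "rooted_iso f (pinduced G S, v) (pinduced H (f ` S), f v)"
proof -
  have "inj_on f S" using assms inj_on_subset by (auto simp: bij_betw_def)
  moreover have "u \<in> pverts G" if "u \<in> S" for u using that assms(2) by blast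
  ultimately show ?thesis using assms(1) by (simp add: bij_betw_def)
qed

lemma rooted_iso_edge:
  assumes "rooted_iso f (G, r) (H, s)" "pair_graph G" "(u, v) \<in> parcs G"
  shows "(f u, f v) \<in> parcs H"
proof -
  interpret pair_graph G by (rule assms(2))
  have "u \<in> pverts G" "v \<in> pverts G" using in_arcsD1[OF assms(3)] in_arcsD2[OF assms(3)] .
  then show ?thesis using assms(1,3) unfolding rooted_iso.simps by blast
qed

lemma rooted_iso_rtrancl:
  assumes iso: "rooted_iso f (G, r) (H, s)" and G: "pair_graph G"
    and uv: "(u, v) \<in> (parcs G)\<^sup>*"
  shows "(f u, f v) \<in> (parcs H)\<^sup>*"
  using uv
proof (induction rule: rtrancl_induct)
  case base
  show ?case by (rule rtrancl_refl)
next
  case (step v w)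
  show ?case by (rule rtrancl_into_rtrancl[OF step(3) rooted_iso_edge[OF iso G step(2)]])
qed

lemma rooted_iso_connected:
  assumes iso: "rooted_iso f (G, r) (H, s)" and G: "pair_graph G" and H: "pair_graph H"
    and conn: "connected (with_proj G)"
  shows "connected (with_proj H)"
proof -
  have im: "pverts H = f ` pverts G" using iso by (auto simp: bij_betw_def)
  show ?thesis
    using conn rooted_iso_rtrancl[OF iso G]
    unfolding connected_sym_iff[OF G] connected_sym_iff[OF H] im by blast
qed

lemma rooted_iso_connected_pinduced:
  assumes iso: "rooted_iso f (G, r) (H, s)" and G: "pair_graph G" and H: "pair_graph H"
    and S: "S \<subseteq> pverts G" and conn: "connected (with_proj (pinduced G S))"
  shows "f ` S \<subseteq> pverts H" "connected (with_proj (pinduced H (f ` S)))"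
proof -
  show fS: "f ` S \<subseteq> pverts H" using iso S by (auto simp: bij_betw_def)
  show "connected (with_proj (pinduced H (f ` S)))"
    by (rule rooted_iso_connected[OF rooted_iso_pinduced[OF iso S] pair_graph_pinduced[OF G S]
          pair_graph_pinduced[OF H fS] conn])
qed

lemma rooted_iso_relpow:
  assumes iso: "rooted_iso f (G, r) (H, s)" and G: "pair_graph G"
    and uv: "(u, v) \<in> parcs G ^^ n"
  shows "(f u, f v) \<in> parcs H ^^ n"
  using uv
proof (induction n arbitrary: v)
  case (Suc n)
  obtain w where w: "(u, w) \<in> parcs G ^^ n" "(w, v) \<in> parcs G" using Suc.prems by auto
  show ?case by (rule relpow_Suc_I[OF Suc.IH[OF w(1)] rooted_iso_edge[OF iso G w(2)]])
qed simp

lemma rooted_iso_rtrancl_iff: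
  assumes iso: "rooted_iso f (G, r) (H, s)" and "pair_graph G" "pair_graph H" "r \<in> pverts G"
    and uv: "u \<in> pverts G" "v \<in> pverts G"
  shows "(f u, f v) \<in> (parcs H)\<^sup>* \<longleftrightarrow> (u, v) \<in> (parcs G)\<^sup>*"
proof -
  have b: "bij_betw f (pverts G) (pverts H)" using iso by simp
  show ?thesis
    using rooted_iso_rtrancl[OF iso assms(2), of u v]
      rooted_iso_rtrancl[OF rooted_iso_inv[OF iso assms(4)] assms(3), of "f u" "f v"]
      bij_betw_inv_into_left[OF b] uv by auto
qed

lemma rooted_iso_dist:
  assumes iso: "rooted_iso f (G, r) (H, s)" and "pair_graph G" "pair_graph H" "r \<in> pverts G"
    and uv: "u \<in> pverts G" "v \<in> pverts G"
  shows "graph_dist H (f u) (f v) = graph_dist G u v"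
proof -
  have b: "bij_betw f (pverts G) (pverts H)" using iso by simp
  have "(f u, f v) \<in> parcs H ^^ n \<longleftrightarrow> (u, v) \<in> parcs G ^^ n" for n
    using rooted_iso_relpow[OF iso assms(2), of u v]
      rooted_iso_relpow[OF rooted_iso_inv[OF iso assms(4)] assms(3), of "f u" "f v"]
      bij_betw_inv_into_left[OF b] uv by auto
  then show ?thesis by (simp add: graph_dist_def)
qed

lemma rooted_iso_root_subtree:
  assumes iso: "rooted_iso f (G, r) (H, s)" and "pair_graph G" "pair_graph H"
    and S: "S \<in> root_subtrees G r"
  shows "f ` S \<in> root_subtrees H s"
proof -
  have S': "r \<in> S" "S \<subseteq> pverts G" "connected (with_proj (pinduced G S))"
    using S by (auto simp: root_subtrees_def)
  have "s \<in> f ` S" using S'(1) iso by auto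
  then show ?thesis
    using rooted_iso_connected_pinduced[OF iso assms(2,3) S'(2,3)] by (simp add: root_subtrees_def)
qed

lemma bij_betw_root_subtrees:
  assumes iso: "rooted_iso f (G, r) (H, s)" and G: "pair_graph G" "pair_graph H" "r \<in> pverts G"
  shows "bij_betw ((`) f) (root_subtrees G r) (root_subtrees H s)"
proof -
  have b: "inj_on f (pverts G)" "f ` pverts G = pverts H" using iso by (auto simp: bij_betw_def)
  let ?g = "inv_into (pverts G) f"
  show ?thesis
  proof (rule bij_betw_byWitness[where f' = "(`) ?g"])
    show "\<forall>S\<in>root_subtrees G r. ?g ` f ` S = S"
      using inv_into_image_cancel[OF b(1)] by (simp add: root_subtrees_def)
    show "\<forall>S\<in>root_subtrees H s. f ` ?g ` S = S"
      using image_inv_into_cancel[OF b(2)] by (simp add: root_subtrees_def)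
    show "(`) f ` root_subtrees G r \<subseteq> root_subtrees H s"
      using rooted_iso_root_subtree[OF iso G(1,2)] by blast
    show "(`) ?g ` root_subtrees H s \<subseteq> root_subtrees G r"
      using rooted_iso_root_subtree[OF rooted_iso_inv[OF iso G(3)] G(2,1)] by blast
  qed
qed

lemma pair_graph_components:
  assumes "pair_graph G"
  shows "pre_digraph.sccs_verts (with_proj G) =
           (\<lambda>u. {v \<in> pverts G. (u, v) \<in> (parcs G)\<^sup>*}) ` pverts G"
proof -
  interpret pair_graph G by fact
  have "scc_of u = {v \<in> pverts G. (u, v) \<in> (parcs G)\<^sup>*}" if "u \<in> pverts G" for u
  proof -
    have "scc_of u = {v. u \<rightarrow>\<^sup>*\<^bsub>with_proj G\<^esub> v}"
      unfolding scc_of_def using symmetric_reachable' by blast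
    also have "\<dots> = {v \<in> pverts G. (u, v) \<in> (parcs G)\<^sup>*}"
      using reachable_conv'[OF that] reachable_in_verts(2) by auto
    finally show ?thesis .
  qed
  then show ?thesis using sccs_verts_conv_scc_of by auto
qed

lemma rooted_iso_components:
  assumes iso: "rooted_iso f (G, r) (H, s)" and G: "pair_graph G" "pair_graph H"
  shows "pre_digraph.sccs_verts (with_proj H) = (`) f ` pre_digraph.sccs_verts (with_proj G)"
proof -
  have im: "pverts H = f ` pverts G" using iso by (auto simp: bij_betw_def)
  have "f ` {v \<in> pverts G. (u, v) \<in> (parcs G)\<^sup>*} = {v \<in> pverts H. (f u, v) \<in> (parcs H)\<^sup>*}"
    if u: "u \<in> pverts G" for u
  proof -
    have "rooted_iso f (G, u) (H, f u)" using iso by simp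
    from rooted_iso_rtrancl_iff[OF this G u u] show ?thesis unfolding im by auto
  qed
  then show ?thesis
    unfolding pair_graph_components[OF G(1)] pair_graph_components[OF G(2)] im image_image
    by (intro image_cong) auto
qed

lemma rooted_iso_complement_components:
  assumes iso: "rooted_iso f (G, r) (H, s)" and G: "pair_graph G" "pair_graph H"
    and S: "S \<subseteq> pverts G"
  shows "complement_components H (f ` S) = (`) f ` complement_components G S"
proof -
  have b: "inj_on f (pverts G)" "f ` pverts G = pverts H" using iso by (auto simp: bij_betw_def)
  have eq: "pverts H - f ` S = f ` (pverts G - S)"
    using b S by (metis inj_on_image_set_diff Diff_subset)
  have iso': "rooted_iso f (pinduced G (pverts G - S), r) (pinduced H (pverts H - f ` S), f r)"
    unfolding eq by (rule rooted_iso_pinduced[OF iso]) auto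
  show ?thesis
    unfolding complement_components_def
    by (rule rooted_iso_components[OF iso']) (auto intro: pair_graph_pinduced G)
qed

lemma rooted_iso_closest_vertex:
  assumes iso: "rooted_iso f (G, r) (H, s)"
    and T: "is_rooted_tree (G, r)" "is_rooted_tree (H, s)"
    and C: "C \<subseteq> pverts G" "C \<noteq> {}" "connected (with_proj (pinduced G C))"
  shows "closest_vertex H s (f ` C) = f (closest_vertex G r C)"
proof -
  have G: "pair_graph G" "pair_graph H" "r \<in> pverts G" and s: "s = f r"
    using T iso by auto
  interpret G: pair_graph G by fact
  note fC = rooted_iso_connected_pinduced[OF iso G(1,2) C(1,3)]
  have fin: "finite C" "finite (f ` C)" using finite_subset[OF C(1) G.pair_finite_verts] by auto
  note cG = closest_vertex_in[OF fin(1) C(2), where G = G and r = r]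
  have ne: "f ` C \<noteq> {}" using C(2) by simp
  note cH = closest_vertex_in[OF fin(2) ne, where G = H and r = s]
  have dist: "graph_dist H s (f w) = graph_dist G r w" if "w \<in> C" for w
    unfolding s using rooted_iso_dist[OF iso G G(3)] that C(1) by blast
  show ?thesis
  proof (rule closest_unique[OF T(2) fC cH(1) _ cH(2)])
    show "f (closest_vertex G r C) \<in> f ` C" using cG(1) by simp
    fix w assume "w \<in> f ` C"
    then show "graph_dist H s (f (closest_vertex G r C)) \<le> graph_dist H s w"
      using cG dist by auto
  qed
qed

section \<open>Trees up to isomorphism\<close>

quotient_type rtree = "nat rgraph" / partial: rooted_tree_iso
proof (rule part_equivpI)
  show "\<exists>T :: nat rgraph. rooted_tree_iso T T"
    by (rule exI, rule rooted_tree_iso_refl[OF single_vertex_tree])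
  show "symp (rooted_tree_iso :: nat rgraph \<Rightarrow> _)"
    by (rule sympI) (rule rooted_tree_iso_sym)
  show "transp (rooted_tree_iso :: nat rgraph \<Rightarrow> _)"
    by (rule transpI) (rule rooted_tree_iso_trans)
qed

lemma abs_rtree_eqI: "rooted_tree_iso T U \<Longrightarrow> abs_rtree T = abs_rtree U"
  by (rule Quotient_rel_abs[OF Quotient_rtree])

lift_definition bullet :: rtree is "(\<lparr>pverts = {0}, parcs = {}\<rparr>, 0)"
  by (rule rooted_tree_iso_refl[OF single_vertex_tree])

lift_definition num_vertices :: "rtree \<Rightarrow> nat" is "\<lambda>(G, r). card (pverts G)"
  by (auto simp: rooted_tree_iso_def dest: bij_betw_same_card)

definition automorphisms :: "'v rgraph \<Rightarrow> ('v \<Rightarrow> 'v) set" where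
  "automorphisms T = {f. f permutes pverts (fst T) \<and> rooted_iso f T T}"

lemma finite_automorphisms: "is_rooted_tree T \<Longrightarrow> finite (automorphisms T)"
proof -
  assume "is_rooted_tree T"
  then interpret pair_graph "fst T" by (cases T) auto
  show ?thesis
    unfolding automorphisms_def using finite_permutations[OF pair_finite_verts] by simp
qed

lemma card_automorphisms_le:
  assumes "rooted_tree_iso T U"
  shows "card (automorphisms T) \<le> card (automorphisms U)"
proof -
  obtain G r H s where TU: "T = (G, r)" "U = (H, s)" by (cases T; cases U)
  have T: "is_rooted_tree T" "is_rooted_tree U" using assms by (auto simp: rooted_tree_iso_def)
  obtain h where h: "rooted_iso h (G, r) (H, s)" using assms by (auto simp: rooted_tree_iso_def TU)
  have r: "r \<in> pverts G" using T TU by simp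
  define g where "g = inv_into (pverts G) h"
  have g: "rooted_iso g (H, s) (G, r)" unfolding g_def by (rule rooted_iso_inv[OF h r])
  have b: "bij_betw h (pverts G) (pverts H)" using h by simp
  have gh: "g (h v) = v" "h v \<in> pverts H" if "v \<in> pverts G" for v
    using that b bij_betw_inv_into_left[OF b] by (auto simp: g_def dest: bij_betwE)
  define \<Phi> where "\<Phi> = (\<lambda>f v. if v \<in> pverts H then (h \<circ> f \<circ> g) v else v)"
  have "\<Phi> f \<in> automorphisms U" if "f \<in> automorphisms T" for f
  proof -
    have "rooted_iso f (G, r) (G, r)" using that by (simp add: automorphisms_def TU)
    from rooted_iso_comp[OF rooted_iso_comp[OF g this] h]
    have *: "rooted_iso (h \<circ> (f \<circ> g)) (H, s) (H, s)" .
    have s: "s \<in> pverts H" using T TU by simp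
    have bij: "bij_betw (\<Phi> f) (pverts H) (pverts H)"
      using * by (simp add: \<Phi>_def comp_assoc cong: bij_betw_cong)
    then have "\<Phi> f permutes pverts H" by (rule bij_imp_permutes) (simp add: \<Phi>_def)
    moreover have "rooted_iso (\<Phi> f) (H, s) (H, s)" using * bij s by (simp add: \<Phi>_def)
    ultimately show ?thesis by (simp add: automorphisms_def TU)
  qed
  moreover have "inj_on \<Phi> (automorphisms T)"
  proof (rule inj_onI)
    fix f f' assume f: "f \<in> automorphisms T" "f' \<in> automorphisms T" and eq: "\<Phi> f = \<Phi> f'"
    have p: "f permutes pverts G" "f' permutes pverts G" using f by (auto simp: automorphisms_def TU)
    show "f = f'"
    proof
      fix v show "f v = f' v"
      proof (cases "v \<in> pverts G")
        case True
        have "h (f v) = h (f' v)"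
          using fun_cong[OF eq, of "h v"] gh[OF True] by (simp add: \<Phi>_def)
        moreover have "f v \<in> pverts G" "f' v \<in> pverts G"
          using p True by (auto simp: permutes_in_image)
        ultimately show ?thesis using gh(1) by metis
      qed (use p in \<open>simp add: permutes_not_in\<close>)
    qed
  qed
  ultimately show ?thesis
    using card_inj_on_le[of \<Phi> "automorphisms T" "automorphisms U"] finite_automorphisms[OF T(2)]
    by blast
qed

lift_definition aut :: "rtree \<Rightarrow> nat" is "\<lambda>T. card (automorphisms T)"
  by (rule antisym[OF card_automorphisms_le card_automorphisms_le[OF rooted_tree_iso_sym]])

section \<open>Tree series\<close>

text \<open>
  The function \<open>A\<close> stands for the formal sum \<open>\<Sum>T. A T \<cdot> T / aut T\<close>: its values are the
  coefficients in the normalisation by \<open>aut\<close>.  Hence a single tree \<open>S\<close>, viewed as a series, has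
  the coefficient \<open>aut S\<close> at \<open>S\<close>.
\<close>

type_synonym 'a tree_series = "rtree \<Rightarrow> 'a"

definition series_of_tree :: "rtree \<Rightarrow> 'a :: comm_ring_1 tree_series" where
  "series_of_tree S = (\<lambda>T. if T = S then of_nat (aut S) else 0)"

lemma aut_bullet: "aut bullet = 1"
proof -
  have "automorphisms (\<lparr>pverts = {0}, parcs = {}\<rparr>, 0 :: nat) = {id}"
    by (auto simp: automorphisms_def)
  then show ?thesis by transfer simp
qed

lemma series_of_bullet: "series_of_tree bullet T = (if T = bullet then 1 else 0)"
  by (simp add: series_of_tree_def aut_bullet)

definition scale :: "'a :: comm_ring_1 \<Rightarrow> 'a tree_series \<Rightarrow> 'a tree_series" where
  "scale c A = (\<lambda>T. c * A T)"

definition suspension :: "'a :: comm_ring_1 \<Rightarrow> 'a tree_series \<Rightarrow> 'a tree_series" where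
  "suspension \<alpha> A = (\<lambda>T. \<alpha> ^ (num_vertices T - 1) * A T)"

lift_definition Crls :: "'a :: comm_ring_1 tree_series \<Rightarrow> 'a tree_series \<Rightarrow> 'a tree_series" is
  "\<lambda>A B (G, r). \<Sum>S\<in>root_subtrees G r.
     A (abs_rtree (pinduced G S, r)) *
     (\<Prod>C\<in>complement_components G S. B (abs_rtree (pinduced G C, closest_vertex G r C)))"
proof -
  fix A B :: "'a tree_series" and T U :: "nat rgraph"
  assume iso: "rooted_tree_iso T U"
  obtain G r H s where TU: "T = (G, r)" "U = (H, s)" by (cases T; cases U)
  have trees: "is_rooted_tree (G, r)" "is_rooted_tree (H, s)"
    using iso by (auto simp: rooted_tree_iso_def TU)
  then have G: "pair_graph G" "pair_graph H" "r \<in> pverts G" by auto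
  obtain f where f: "rooted_iso f (G, r) (H, s)" using iso by (auto simp: rooted_tree_iso_def TU)
  have inj: "inj_on f (pverts G)" and fr: "f r = s" using f by (auto simp: bij_betw_def)
  have same: "abs_rtree (pinduced G S, v) = abs_rtree (pinduced H (f ` S), f v)"
    if S: "S \<subseteq> pverts G" "connected (with_proj (pinduced G S))" "v \<in> S" for S v
  proof (rule abs_rtree_eqI)
    note fS = rooted_iso_connected_pinduced[OF f G(1,2) S(1,2)]
    have i: "rooted_iso f (pinduced G S, v) (pinduced H (f ` S), f v)"
      by (rule rooted_iso_pinduced[OF f S(1)])
    have "f v \<in> f ` S" using S(3) by simp
    then show "rooted_tree_iso (pinduced G S, v) (pinduced H (f ` S), f v)"
      unfolding rooted_tree_iso_def
      using i is_rooted_tree_pinduced[OF trees(1) S] is_rooted_tree_pinduced[OF trees(2) fS]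
      by blast
  qed
  have prods: "(\<Prod>C\<in>complement_components H (f ` S).
                  B (abs_rtree (pinduced H C, closest_vertex H s C))) =
               (\<Prod>C\<in>complement_components G S.
                  B (abs_rtree (pinduced G C, closest_vertex G r C)))"
    if S: "S \<in> root_subtrees G r" for S
  proof -
    have S': "S \<subseteq> pverts G" using S by (simp add: root_subtrees_def)
    have sub: "C \<subseteq> pverts G" if "C \<in> complement_components G S" for C
      using complement_components_props(1)[OF G(1) that] by auto
    have "inj_on ((`) f) (complement_components G S)"
      using inj sub by (intro inj_onI) (metis inj_on_image_eq_iff)
    moreover have "abs_rtree (pinduced H (f ` C), closest_vertex H s (f ` C)) =
                   abs_rtree (pinduced G C, closest_vertex G r C)"
      if C: "C \<in> complement_components G S" for C
    proof -
      note p = complement_components_props(2,3)[OF G(1) C]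
      interpret G: pair_graph G by fact
      have "finite C" using sub[OF C] G.pair_finite_verts finite_subset by blast
      then show ?thesis
        using same[OF sub[OF C] p(2) closest_vertex_in(1)[OF _ p(1)]]
          rooted_iso_closest_vertex[OF f trees sub[OF C] p] by simp
    qed
    ultimately show ?thesis
      unfolding rooted_iso_complement_components[OF f G(1,2) S']
      by (simp add: prod.reindex)
  qed
  have "(\<Sum>S\<in>root_subtrees G r. A (abs_rtree (pinduced G S, r)) *
          (\<Prod>C\<in>complement_components G S. B (abs_rtree (pinduced G C, closest_vertex G r C)))) =
        (\<Sum>S\<in>root_subtrees G r. A (abs_rtree (pinduced H (f ` S), s)) *
          (\<Prod>C\<in>complement_components H (f ` S).
             B (abs_rtree (pinduced H C, closest_vertex H s C))))"
    using prods same fr by (intro sum.cong refl arg_cong2[where f = "(*)"])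
      (auto simp: root_subtrees_def)
  also have "\<dots> = (\<Sum>S\<in>root_subtrees H s. A (abs_rtree (pinduced H S, s)) *
          (\<Prod>C\<in>complement_components H S. B (abs_rtree (pinduced H C, closest_vertex H s C))))"
    by (rule sum.reindex_bij_betw[OF bij_betw_root_subtrees[OF f G]])
  finally show "(case T of (G, r) \<Rightarrow> \<Sum>S\<in>root_subtrees G r. A (abs_rtree (pinduced G S, r)) *
          (\<Prod>C\<in>complement_components G S. B (abs_rtree (pinduced G C, closest_vertex G r C)))) =
        (case U of (G, r) \<Rightarrow> \<Sum>S\<in>root_subtrees G r. A (abs_rtree (pinduced G S, r)) *
          (\<Prod>C\<in>complement_components G S. B (abs_rtree (pinduced G C, closest_vertex G r C))))"
    by (simp add: TU)
qed

section \<open>The ring \<open>\<rat>(q)[x]\<close>\<close>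

definition qq :: "rat poly fract poly" where
  "qq = [:Fract [:0, 1:] 1:]"

definition xx :: "rat poly fract poly" where
  "xx = [:0, 1:]"

end

theory Submission
  imports Defs
begin

text \<open>
  At a tree \<open>T\<close> with \<open>n\<close> vertices the equation reads
  \<open>(q^n - 1) Z\<^sub>T = \<Phi>\<^sub>T(Z)\<close>, where \<open>\<Phi>\<^sub>T(Z)\<close> involves only the coefficients of \<open>Z\<close> at trees with
  fewer than \<open>n\<close> vertices: in the first \<open>Crls\<close> the only subtree of full size is \<open>T\<close> itself,
  contributing \<open>Z\<^sub>T\<close>, and in the second one the components of the complement never contain the root.
  As \<open>q^n - 1\<close> is a unit of \<open>\<rat>(q)[x]\<close>, this determines \<open>Z\<close> by recursion on the number of vertices.
\<close>

text \<open>Well-founded recursion along \<open>m\<close>: locality is admissibility of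
  \<open>F\<close>, so \<open>wfrec\<close> yields a fixpoint, and induction on \<open>m x\<close>
  forces any other fixpoint to agree with it.\<close>

lemma ex1_fixpoint_measure:
  fixes m :: "'a \<Rightarrow> nat" and F :: "('a \<Rightarrow> 'b) \<Rightarrow> 'a \<Rightarrow> 'b"
  assumes local: "\<And>f g x. (\<And>y. m y < m x \<Longrightarrow> f y = g y) \<Longrightarrow> F f x = F g x"
  shows "\<exists>!f. f = F f"
proof (rule ex1I)
  have "adm_wf (measure m) F"
    unfolding adm_wf_def by (intro allI impI local) simp
  then show wfrec: "wfrec (measure m) F = F (wfrec (measure m) F)"
    by (rule wfrec_fixpoint[OF wf_measure])
  fix f assume f: "f = F f"
  have "f x = wfrec (measure m) F x" for x
  proof (induction "m x" arbitrary: x rule: less_induct)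
    case less
    have "f x = F f x" by (rule fun_cong[OF f])
    also have "\<dots> = F (wfrec (measure m) F) x" by (intro local less)
    also have "\<dots> = wfrec (measure m) F x" by (rule fun_cong[OF wfrec, symmetric])
    finally show ?case .
  qed
  then show "f = wfrec (measure m) F" ..
qed

text \<open>The quotient is partial, so a representative is known to be a rooted tree only because
  it is related to itself.\<close>

lemma rtree_cases:
  obtains G r where "T = abs_rtree (G, r)" "is_rooted_tree (G, r)"
proof -
  have "rooted_tree_iso (rep_rtree T) (rep_rtree T)"
    by (rule Quotient_rep_reflp[OF Quotient_rtree])
  then have "is_rooted_tree (rep_rtree T)" by (simp add: rooted_tree_iso_def)
  moreover have "T = abs_rtree (rep_rtree T)"
    by (rule Quotient_abs_rep[OF Quotient_rtree, symmetric])
  ultimately show thesis using that by (cases "rep_rtree T") auto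
qed

lemma num_vertices_abs:
  "is_rooted_tree (G, r) \<Longrightarrow> num_vertices (abs_rtree (G, r)) = card (pverts G)"
  using num_vertices.abs_eq[of "(G, r)"] rooted_tree_iso_refl[of "(G, r)"] by simp

lemma Crls_abs:
  "is_rooted_tree (G, r) \<Longrightarrow> Crls A B (abs_rtree (G, r)) =
     (\<Sum>S\<in>root_subtrees G r. A (abs_rtree (pinduced G S, r)) *
       (\<Prod>C\<in>complement_components G S. B (abs_rtree (pinduced G C, closest_vertex G r C))))"
  using Crls.abs_eq[of "(G, r)" A B] rooted_tree_iso_refl[of "(G, r)"] by simp

lemma num_vertices_pos: "0 < num_vertices T"
proof (cases T rule: rtree_cases)
  case (1 G r)
  then interpret pair_graph G by simp
  show ?thesis using 1 by (auto simp: num_vertices_abs card_gt_0_iff)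
qed

lemma num_vertices_pinduced:
  assumes T: "is_rooted_tree (G, r)" and S: "S \<subset> pverts G"
    and conn: "connected (with_proj (pinduced G S))" and v: "v \<in> S"
  shows "num_vertices (abs_rtree (pinduced G S, v)) < num_vertices (abs_rtree (G, r))"
proof -
  interpret pair_graph G using T by simp
  have "is_rooted_tree (pinduced G S, v)"
    using is_rooted_tree_pinduced[OF T _ conn v] S by blast
  then show ?thesis
    using T psubset_card_mono[OF pair_finite_verts S] by (simp add: num_vertices_abs)
qed

text \<open>Subtracting \<open>A T\<close> cancels exactly the summand of the full vertex set; every
  other root subtree is a proper subset, hence a smaller tree.\<close>

lemma Crls_cong_left:
  fixes A A' B :: "'a :: comm_ring_1 tree_series"
  assumes eq: "\<And>U. num_vertices U < num_vertices T \<Longrightarrow> A U = A' U"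
  shows "Crls A B T - A T = Crls A' B T - A' T"
proof (cases T rule: rtree_cases)
  case (1 G r)
  then have G: "pair_graph G" and conn: "connected (with_proj G)" and r: "r \<in> pverts G" by auto
  interpret pair_graph G by fact
  let ?V = "pverts G"
  let ?P = "\<lambda>S. \<Prod>C\<in>complement_components G S. B (abs_rtree (pinduced G C, closest_vertex G r C))"
  let ?t = "\<lambda>A S. A (abs_rtree (pinduced G S, r)) * ?P S"
  have full: "pinduced G ?V = G"
    by (rule pair_pre_digraph.equality) (auto dest: wellformed')
  have fin: "finite (root_subtrees G r)"
    by (rule finite_subset[of _ "Pow ?V"]) (auto simp: root_subtrees_def)
  have V: "?V \<in> root_subtrees G r" using r conn full by (simp add: root_subtrees_def)
  \<comment> \<open>A component would be a nonempty subset of the empty set; the product is thus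
    empty and the full summand is \<open>A T\<close> times 1.\<close>
  have none: "complement_components G ?V = {}"
    using complement_components_props(1,2)[OF G, of _ ?V] by auto
  have split: "Crls A B T - A T = (\<Sum>S\<in>root_subtrees G r - {?V}. ?t A S)" for A
    using 1 sum.remove[OF fin V, of "?t A"] by (simp add: Crls_abs full none)
  have "A (abs_rtree (pinduced G S, r)) = A' (abs_rtree (pinduced G S, r))"
    if "S \<in> root_subtrees G r - {?V}" for S
    unfolding 1(1)
    by (rule eq[unfolded 1(1)], rule num_vertices_pinduced[OF 1(2)])
      (use that in \<open>auto simp: root_subtrees_def\<close>)
  then show ?thesis unfolding split by (intro sum.cong) auto
qed

text \<open>Nothing has to be subtracted here: a component misses the root, which lies in
  \<open>S\<close>, so \<open>B\<close> is never evaluated at a tree as large as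
  \<open>T\<close>.\<close>

lemma Crls_cong_right:
  fixes A B B' :: "'a :: comm_ring_1 tree_series"
  assumes eq: "\<And>U. num_vertices U < num_vertices T \<Longrightarrow> B U = B' U"
  shows "Crls A B T = Crls A B' T"
proof (cases T rule: rtree_cases)
  case (1 G r)
  then have G: "pair_graph G" by auto
  interpret pair_graph G by fact
  have "B (abs_rtree (pinduced G C, closest_vertex G r C)) =
        B' (abs_rtree (pinduced G C, closest_vertex G r C))"
    if S: "S \<in> root_subtrees G r" and C: "C \<in> complement_components G S" for S C
  proof -
    note p = complement_components_props[OF G C]
    \<comment> \<open>Finiteness ensures that the minimum of the distance is attained, so that the
      chosen root is a vertex of \<open>C\<close>.\<close>
    have "finite C" using p(1) pair_finite_verts by (meson Diff_subset finite_subset subset_trans)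
    then have v: "closest_vertex G r C \<in> C" by (rule closest_vertex_in(1)[OF _ p(2)])
    have "C \<subset> pverts G" using p(1) S by (auto simp: root_subtrees_def)
    from num_vertices_pinduced[OF 1(2) this p(3) v] show ?thesis
      by (intro eq) (simp add: 1(1))
  qed
  then show ?thesis using 1 by (simp add: Crls_abs)
qed

text \<open>The outer factor \<open>c\<close> makes up for the exponent
  \<open>num_vertices T - 1\<close>, whose subtraction is not truncated because a tree has a
  vertex.\<close>

lemma scale_suspension:
  "scale c (suspension c Z) T = c ^ num_vertices T * Z T"
  using num_vertices_pos[of T]
  by (cases "num_vertices T") (simp_all add: scale_def suspension_def mult.assoc)

text \<open>Clearing denominators moves the equation to polynomials over the rationals, where the
  degrees n and 0 differ.\<close>

lemma Fract_var_power_neq_1: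
  assumes "0 < n"
  shows "(Fract [:0, 1:] 1 :: rat poly fract) ^ n \<noteq> 1"
proof
  assume eq: "(Fract [:0, 1:] 1 :: rat poly fract) ^ n = 1"
  have "(Fract p 1) ^ n = Fract (p ^ n) 1" for p :: "rat poly"
    by (induction n) (simp_all add: One_fract_def)
  then have "[:0, 1:] ^ n = (1 :: rat poly)" using eq by (simp add: One_fract_def eq_fract)
  then have "degree ([:0, 1 :: rat:] ^ n) = 0" by simp
  then show False using assms by (simp add: degree_power_eq)
qed

text \<open>The element is a constant polynomial in x, and a nonzero constant is invertible because
  the coefficients form a field.\<close>

lemma qq_power_minus_1_unit:
  assumes "0 < n"
  shows "qq ^ n - 1 dvd 1"
proof -
  let ?c = "(Fract [:0, 1:] 1 :: rat poly fract) ^ n - 1"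
  have "qq ^ n - 1 = [:?c:]"
    by (simp add: qq_def poly_const_pow one_pCons)
  moreover have "?c \<noteq> 0" using Fract_var_power_neq_1[OF assms] by simp
  ultimately show ?thesis by (simp add: is_unit_const_poly_iff dvd_field_iff)
qed

lemma mult_eq_iff_eq_inverse_mult:
  fixes a u x c :: "'a :: comm_monoid_mult"
  assumes "a * u = 1"
  shows "a * x = c \<longleftrightarrow> x = u * c"
  using assms by (metis mult.assoc mult.commute mult_1)

theorem mainTheorem1:
  shows "\<exists>!Z :: rat poly fract poly tree_series.
    scale qq (suspension qq Z) - Crls Z (- series_of_tree bullet) =
    scale (qq * (1 + (qq - 1) * xx))
      (Crls (series_of_tree bullet) (scale qq (suspension qq Z))) - series_of_tree bullet"
proof -
  let ?b = "series_of_tree bullet :: rat poly fract poly tree_series"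
  have "\<exists>u. \<forall>T. (qq ^ num_vertices T - 1) * u T = 1"
    using qq_power_minus_1_unit[OF num_vertices_pos] by (intro choice allI) (metis dvdE)
  then obtain u where u: "(qq ^ num_vertices T - 1) * u T = 1" for T by blast
  define R where "R Z = scale (qq * (1 + (qq - 1) * xx)) (Crls ?b (scale qq (suspension qq Z))) - ?b"
    for Z
  \<comment> \<open>The equation at \<open>T\<close> solved for \<open>Z T\<close>; grouping
    \<open>- Z T\<close> with the first \<open>Crls\<close> removes the dependence on
    \<open>Z T\<close> itself, which makes \<open>F\<close> local.\<close>
  define F where "F Z T = u T * (Crls Z (- ?b) T - Z T + R Z T)" for Z T
  have R_cong: "R Z T = R Z' T" if "\<And>U. num_vertices U < num_vertices T \<Longrightarrow> Z U = Z' U" for Z Z' T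
  proof -
    have "Crls ?b (scale qq (suspension qq Z)) T = Crls ?b (scale qq (suspension qq Z')) T"
      by (rule Crls_cong_right) (simp add: scale_suspension that)
    then show ?thesis by (simp add: R_def scale_def)
  qed
  have "F Z T = F Z' T" if "\<And>U. num_vertices U < num_vertices T \<Longrightarrow> Z U = Z' U" for Z Z' T
    unfolding F_def
    by (simp only: R_cong[of T Z Z', OF that] Crls_cong_left[of T Z Z', OF that])
  then have ex1: "\<exists>!Z. Z = F Z" by (rule ex1_fixpoint_measure[where m = num_vertices])
  have iff: "scale qq (suspension qq Z) - Crls Z (- ?b) = R Z \<longleftrightarrow> Z = F Z" for Z
  proof -
    have "qq ^ num_vertices T * Z T - Crls Z (- ?b) T = R Z T \<longleftrightarrow> Z T = F Z T" for T
    proof -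
      have "qq ^ num_vertices T * Z T - Crls Z (- ?b) T = R Z T \<longleftrightarrow>
            (qq ^ num_vertices T - 1) * Z T = Crls Z (- ?b) T - Z T + R Z T" (is "_ \<longleftrightarrow> ?a * _ = ?c")
        by (auto simp: algebra_simps)
      also have "\<dots> \<longleftrightarrow> Z T = u T * ?c"
        by (rule mult_eq_iff_eq_inverse_mult[OF u])
      finally show ?thesis unfolding F_def .
    qed
    then show ?thesis by (simp add: fun_eq_iff scale_suspension)
  qed
  show ?thesis unfolding iff[unfolded R_def] by (rule ex1)
qed

end
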